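(* Let $A$ be a commutative ring on which a finite group $G$ acts by ring automorphisms, let $\mathfrak m\subseteq A$ be a $G$-invariant ideal, and let $H\subseteq G$ be a subgroup such that the index $[G:H]$ is invertible in $A$. Then $$\eta_G(\mathfrak m)\le [G:H]\,\eta_H(\mathfrak m).$$
   Context: For a subset $S\subseteq A$, $\langle S\rangle$ denotes the ideal of $A$ generated by $S$. $\mathfrak m^G$ denotes the set of $G$-invariant elements of $\mathfrak m$. For a finite group $G$ acting on a commutative ring $A$ and a $G$-invariant ideal $\mathfrak m$, define $\eta_G(\mathfrak m):=\inf\{d\in\mathbb N\mid \mathfrak m^d\subseteq\langle\mathfrak m^G\rangle\}$, with $\mathbb N=\{0,1,2,\dots\}$, $\mathfrak m^0=A$ and $\inf\emptyset=\infty$. $\eta_H(\mathfrak m)$ is defined in the same way for the restricted action of $H$. *)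

theory Defs
  imports "HOL-Algebra.Algebra" "HOL-Library.Extended_Nat"
begin

definition fixed_points :: "('g, 'c) monoid_scheme \<Rightarrow> ('g \<Rightarrow> 'a \<Rightarrow> 'a) \<Rightarrow> 'a set \<Rightarrow> 'a set"
  where "fixed_points G \<phi> m = {x \<in> m. \<forall>g \<in> carrier G. \<phi> g x = x}"

text \<open>
  Powers of \<open>m\<close> are taken in the multiplicative monoid \<^const>\<open>ideals_set\<close> of ideals of \<open>A\<close>,
  whose unit is \<open>carrier A\<close>; thus the zeroth power of \<open>m\<close> is the whole ring. In the complete
  lattice \<^typ>\<open>enat\<close> the infimum of the empty set is \<open>\<infinity>\<close>.
\<close>

definition eta :: "('a, 'b) ring_scheme \<Rightarrow> ('g, 'c) monoid_scheme \<Rightarrow> ('g \<Rightarrow> 'a \<Rightarrow> 'a) \<Rightarrow> 'a set \<Rightarrow> enat"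
  where "eta A G \<phi> m =
    Inf {enat d | d. m [^]\<^bsub>ideals_set A\<^esub> d \<subseteq> Idl\<^bsub>A\<^esub> (fixed_points G \<phi> m)}"

end

theory Submission
  imports Defs
begin

text \<open>
  Let \<open>s\<close> run over a system of representatives of the left cosets of \<open>H\<close>. For \<open>H\<close>-invariant
  elements \<open>f\<^sub>s\<close> of \<open>m\<close>, the product \<open>\<Prod>\<^sub>t (t f\<^sub>t - s f\<^sub>t)\<close> vanishes for every \<open>s\<close>, because its
  factor at \<open>t = s\<close> does. Expanding these products and summing over \<open>s\<close>, every term except
  \<open>[G:H] \<Prod>\<^sub>t t f\<^sub>t\<close> is a multiple of a relative trace \<open>\<Sum>\<^sub>s s (\<Prod>\<^sub>t\<^sub>\<in>\<^sub>S f\<^sub>t)\<close>, which is a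
  \<open>G\<close>-invariant element of \<open>m\<close>. As \<open>[G:H]\<close> is invertible, the product of the translates
  \<open>t \<langle>m\<^sup>H\<rangle>\<close> lies in \<open>\<langle>m\<^sup>G\<rangle>\<close>. If \<open>m\<^sup>d \<subseteq> \<langle>m\<^sup>H\<rangle>\<close>, each translate contains \<open>t m\<^sup>d = m\<^sup>d\<close>.
\<close>

section \<open>Colon ideals and membership of products in an ideal\<close>

text \<open>Passing from \<open>J\<close> to the colon ideal of \<open>J\<close> by \<open>S\<close>
  absorbs one factor of a product. The inductions over products below keep \<open>J\<close>
  arbitrary and apply their hypothesis to such a colon ideal.\<close>

lemma (in cring) ideal_colon:
  assumes "ideal J R" "S \<subseteq> carrier R"
  shows "ideal {y \<in> carrier R. \<forall>x\<in>S. y \<otimes> x \<in> J} R"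
proof -
  interpret J: ideal J R by fact
  show ?thesis
  proof (rule idealI[OF ring_axioms])
    show "subgroup {y \<in> carrier R. \<forall>x\<in>S. y \<otimes> x \<in> J} (add_monoid R)"
    proof (rule add.subgroupI)
      have "\<zero> \<in> {y \<in> carrier R. \<forall>x\<in>S. y \<otimes> x \<in> J}"
        using assms(2) by auto
      then show "{y \<in> carrier R. \<forall>x\<in>S. y \<otimes> x \<in> J} \<noteq> {}"
        by blast
    next
      fix a assume "a \<in> {y \<in> carrier R. \<forall>x\<in>S. y \<otimes> x \<in> J}"
      then show "\<ominus> a \<in> {y \<in> carrier R. \<forall>x\<in>S. y \<otimes> x \<in> J}"
        using assms(2) by (auto simp: l_minus subset_iff)
    next
      fix a b assume "a \<in> {y \<in> carrier R. \<forall>x\<in>S. y \<otimes> x \<in> J}" "b \<in> {y \<in> carrier R. \<forall>x\<in>S. y \<otimes> x \<in> J}"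
      then show "a \<oplus> b \<in> {y \<in> carrier R. \<forall>x\<in>S. y \<otimes> x \<in> J}"
        using assms(2) by (auto simp: l_distr subset_iff)
    qed auto
  next
    fix a x assume a: "a \<in> {y \<in> carrier R. \<forall>x\<in>S. y \<otimes> x \<in> J}" and x: "x \<in> carrier R"
    show "x \<otimes> a \<in> {y \<in> carrier R. \<forall>x\<in>S. y \<otimes> x \<in> J}"
      using a x assms(2) by (auto simp: m_assoc subset_iff J.I_l_closed)
    then show "a \<otimes> x \<in> {y \<in> carrier R. \<forall>x\<in>S. y \<otimes> x \<in> J}"
      using a x by (simp add: m_comm)
  qed
qed

lemma (in cring) ideal_pow_is_ideal:
  assumes "ideal I R"
  shows "ideal (I [^]\<^bsub>ideals_set R\<^esub> (d::nat)) R"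
proof -
  interpret S: comm_monoid "ideals_set R" by (rule ideals_set_is_comm_monoid)
  show ?thesis
    using S.nat_pow_closed[of I d] assms by (simp add: ideals_set_def)
qed

text \<open>The exponent is written as \<open>card T\<close> so that the factors of a product can
  later be indexed by cosets. Each induction step splits one factor off the power and moves it into
  a colon ideal.\<close>

lemma (in cring) ideal_pow_card_subset:
  assumes "ideal I R" "finite T" "ideal J R"
    and "\<And>f. f \<in> T \<rightarrow> I \<Longrightarrow> (\<Otimes>t\<in>T. f t) \<in> J"
  shows "I [^]\<^bsub>ideals_set R\<^esub> card T \<subseteq> J"
  using assms(2-4)
proof (induction T arbitrary: J rule: finite_induct)
  case empty
  then have "\<one> \<in> J" by simp
  \<comment> \<open>The empty product is \<open>\<one>\<close>, so \<open>J\<close> is the whole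
    ring, as is the zeroth power.\<close>
  then have "J = carrier R" using empty.prems(1) ideal.one_imp_carrier by blast
  then show ?case by (simp add: ideals_set_def)
next
  case (insert t T)
  interpret I: ideal I R by fact
  interpret J: ideal J R by fact
  interpret S: comm_monoid "ideals_set R" by (rule ideals_set_is_comm_monoid)
  let ?Q = "{y \<in> carrier R. \<forall>x\<in>I. y \<otimes> x \<in> J}"
  have "I [^]\<^bsub>ideals_set R\<^esub> card T \<subseteq> ?Q"
  proof (rule insert.IH)
    show "ideal ?Q R" by (rule ideal_colon) (use insert.prems I.a_subset in auto)
    fix f assume f: "f \<in> T \<rightarrow> I"
    then have fc: "f \<in> T \<rightarrow> carrier R" using I.Icarr by (auto simp: Pi_def)
    have "(\<Otimes>t\<in>T. f t) \<otimes> x \<in> J" if x: "x \<in> I" for x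
    proof -
      have xc: "x \<in> carrier R" using x I.Icarr by auto
      let ?g = "f(t := x)"
      have "(\<Otimes>u\<in>insert t T. ?g u) \<in> J"
        by (rule insert.prems(2)) (use f x insert.hyps in auto)
      moreover have "(\<Otimes>u\<in>insert t T. ?g u) = x \<otimes> (\<Otimes>u\<in>T. ?g u)"
        using insert.hyps fc xc by (subst finprod_insert) auto
      moreover have "(\<Otimes>u\<in>T. ?g u) = (\<Otimes>u\<in>T. f u)"
        using insert.hyps fc by (intro finprod_cong') auto
      ultimately show ?thesis using fc xc by (simp add: m_comm)
    qed
    then show "(\<Otimes>t\<in>T. f t) \<in> ?Q" using fc by simp
  qed
  then have "(I [^]\<^bsub>ideals_set R\<^esub> card T) \<cdot> I \<subseteq> J"
  proof (intro subsetI)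
    fix x assume "x \<in> (I [^]\<^bsub>ideals_set R\<^esub> card T) \<cdot> I"
      and sub: "I [^]\<^bsub>ideals_set R\<^esub> card T \<subseteq> ?Q"
    then show "x \<in> J"
      by (induction rule: ideal_prod.induct) auto
  qed
  then show ?case
    using insert.hyps S.nat_pow_Suc[of I "card T"] by (simp add: ideals_set_def)
qed

text \<open>By multiplicativity and additivity of the maps \<open>s t\<close>, a product condition
  on generators extends to the ideal they generate. The slots are treated one at a time: with the
  other factors fixed, the admissible entries of one slot form an ideal.\<close>

lemma (in cring) finprod_hom_genideal:
  assumes "finite T" "M \<subseteq> carrier R" "ideal J R"
    and "\<And>t. t \<in> T \<Longrightarrow> s t \<in> ring_hom R R"
    and "\<And>f. f \<in> T \<rightarrow> M \<Longrightarrow> (\<Otimes>t\<in>T. s t (f t)) \<in> J"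
    and "f \<in> T \<rightarrow> Idl M"
  shows "(\<Otimes>t\<in>T. s t (f t)) \<in> J"
  using assms(1,3-6)
proof (induction T arbitrary: J f rule: finite_induct)
  case empty
  then show ?case by simp
next
  case (insert t T)
  have Kc: "Idl M \<subseteq> carrier R"
    using genideal_ideal[OF assms(2)] additive_subgroup.a_subset ideal.axioms(1) by blast
  have sc: "s u x \<in> carrier R" if "u \<in> insert t T" "x \<in> carrier R" for u x
    using insert.prems(2)[OF that(1)] that(2) by (rule ring_hom_closed)
  let ?P = "\<Otimes>u\<in>T. s u (f u)"
  have fc: "(\<lambda>u. s u (f u)) \<in> T \<rightarrow> carrier R"
    using insert.prems(4) Kc sc by (auto simp: Pi_def)
  have ftc: "f t \<in> Idl M" using insert.prems(4) by auto
  \<comment> \<open>A generator is placed in slot \<open>t\<close> while the induction hypothesis,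
    for the colon ideal by \<open>s t x\<close>, already allows arbitrary elements of
    \<open>Idl M\<close> in the other slots.\<close>
  have *: "s t x \<otimes> ?P \<in> J" if x: "x \<in> M" for x
  proof -
    have xc: "s t x \<in> carrier R" using x assms(2) sc by auto
    have "?P \<in> {y \<in> carrier R. \<forall>z\<in>{s t x}. y \<otimes> z \<in> J}"
    proof (rule insert.IH)
      show "ideal {y \<in> carrier R. \<forall>z\<in>{s t x}. y \<otimes> z \<in> J} R"
        by (rule ideal_colon) (use insert.prems xc in auto)
      show "s u \<in> ring_hom R R" if "u \<in> T" for u using that insert.prems by auto
      show "f \<in> T \<rightarrow> Idl M" using insert.prems by auto
      fix f assume f: "f \<in> T \<rightarrow> M"
      then have fc: "(\<lambda>u. s u (f u)) \<in> T \<rightarrow> carrier R"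
        using assms(2) sc by (auto simp: Pi_def)
      let ?g = "f(t := x)"
      have "(\<Otimes>u\<in>insert t T. s u (?g u)) \<in> J"
        by (rule insert.prems(3)) (use f x insert.hyps in auto)
      moreover have "(\<Otimes>u\<in>insert t T. s u (?g u)) = s t x \<otimes> (\<Otimes>u\<in>T. s u (?g u))"
        using insert.hyps fc xc by (subst finprod_insert) auto
      moreover have "(\<Otimes>u\<in>T. s u (?g u)) = (\<Otimes>u\<in>T. s u (f u))"
        using insert.hyps fc by (intro finprod_cong') auto
      ultimately show "(\<Otimes>u\<in>T. s u (f u)) \<in> {y \<in> carrier R. \<forall>z\<in>{s t x}. y \<otimes> z \<in> J}"
        using fc xc by (simp add: m_comm)
    qed
    then show ?thesis using xc fc by (simp add: m_comm)
  qed
  \<comment> \<open>The set on the right is the preimage under \<open>s t\<close> of the colon ideal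
    by \<open>?P\<close>, hence an ideal; by \<open>*\<close> it contains \<open>M\<close>.\<close>
  have "Idl M \<subseteq> {x \<in> carrier R. s t x \<in> {y \<in> carrier R. \<forall>z\<in>{?P}. y \<otimes> z \<in> J}}"
  proof (rule genideal_minimal)
    show "ideal {x \<in> carrier R. s t x \<in> {y \<in> carrier R. \<forall>z\<in>{?P}. y \<otimes> z \<in> J}} R"
      by (rule ring_hom_ring.ideal_vimage[OF ring_hom_ringI2[OF ring_axioms ring_axioms]],
          use insert.prems in simp, rule ideal_colon, use insert.prems fc in auto)
    show "M \<subseteq> {x \<in> carrier R. s t x \<in> {y \<in> carrier R. \<forall>z\<in>{?P}. y \<otimes> z \<in> J}}"
      using * assms(2) sc by auto
  qed
  then have "s t (f t) \<otimes> ?P \<in> J" using ftc by auto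
  moreover have "(\<Otimes>u\<in>insert t T. s u (f u)) = s t (f t) \<otimes> ?P"
    using insert.hyps fc sc ftc Kc by (subst finprod_insert) auto
  ultimately show ?case by simp
qed

section \<open>Traces and products of translates\<close>

text \<open>
  Modulo \<open>J\<close>, every term of the expanded product that contains some \<open>s i (f t)\<close> sums over
  \<open>i\<close> to a multiple of a trace of an element of \<open>M\<close>, so only \<open>\<Prod>c\<close> survives. The extra factor
  \<open>u\<close> collects the \<open>f t\<close> split off during the induction.
\<close>

lemma (in cring) trace_prod_minus:
  assumes "finite I" "finite T" "ideal J R" "M \<subseteq> carrier R"
    and s: "\<And>i. i \<in> I \<Longrightarrow> s i \<in> ring_hom R R"
    and M: "\<And>x y. x \<in> M \<Longrightarrow> y \<in> M \<Longrightarrow> x \<otimes> y \<in> M"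
    and tr: "\<And>x. x \<in> M \<Longrightarrow> (\<Oplus>i\<in>I. s i x) \<in> J"
    and "u \<in> insert \<one> M" "f \<in> T \<rightarrow> M" "c \<in> T \<rightarrow> carrier R"
  shows "(\<Oplus>i\<in>I. s i u \<otimes> (\<Otimes>t\<in>T. c t \<ominus> s i (f t))) \<ominus> (\<Oplus>i\<in>I. s i u) \<otimes> (\<Otimes>t\<in>T. c t) \<in> J"
  using assms(2,8-10)
proof (induction T arbitrary: u rule: finite_induct)
  interpret J: ideal J R by fact
  have sc: "s i x \<in> carrier R" if "i \<in> I" "x \<in> carrier R" for i x
    using s[OF that(1)] that(2) by (rule ring_hom_closed)
  {
    case empty
    then have "u \<in> carrier R" using assms(4) by auto
    then have *: "(\<lambda>i. s i u) \<in> I \<rightarrow> carrier R" using sc by auto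
    then have "(\<Oplus>i\<in>I. s i u \<otimes> \<one>) = (\<Oplus>i\<in>I. s i u)"
      by (intro finsum_cong') (auto simp: Pi_def)
    then show ?case using * by (simp add: minus_eq r_neg)
  next
    case (insert t T)
    have uc: "u \<in> carrier R" using insert.prems assms(4) by auto
    have ft: "f t \<in> M" "f t \<in> carrier R" and ct: "c t \<in> carrier R"
      and c: "c \<in> T \<rightarrow> carrier R" and f: "f \<in> T \<rightarrow> M"
      using insert.prems assms(4) by auto
    \<comment> \<open>Even for \<open>u = \<one>\<close> the new factor lies in \<open>M\<close>
      itself, so its trace \<open>q\<close> below lies in \<open>J\<close>.\<close>
    have v: "u \<otimes> f t \<in> M" using insert.prems(1) ft M by auto
    define P where "P i = (\<Otimes>t\<in>T. c t \<ominus> s i (f t))" for i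
    define C where "C = (\<Otimes>t\<in>T. c t)"
    have Pc: "P i \<in> carrier R" if "i \<in> I" for i
      unfolding P_def using that c f assms(4) sc by (intro finprod_closed) (auto simp: Pi_def subset_iff)
    have Cc: "C \<in> carrier R" unfolding C_def using c by simp
    \<comment> \<open>Expanding the factor \<open>c t \<ominus> s i (f t)\<close> gives two sums:
      \<open>a\<close> keeps \<open>u\<close>, and \<open>b\<close> replaces it by
      \<open>u \<otimes> f t\<close>. The induction hypothesis compares them with
      \<open>p \<otimes> C\<close> and \<open>q \<otimes> C\<close>.\<close>
    define a where "a = (\<Oplus>i\<in>I. s i u \<otimes> P i)"
    define b where "b = (\<Oplus>i\<in>I. s i (u \<otimes> f t) \<otimes> P i)"
    define p where "p = (\<Oplus>i\<in>I. s i u)"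
    define q where "q = (\<Oplus>i\<in>I. s i (u \<otimes> f t))"
    have cl: "a \<in> carrier R" "b \<in> carrier R" "p \<in> carrier R" "q \<in> carrier R"
      unfolding a_def b_def p_def q_def using sc Pc uc ft by auto
    have IH1: "a \<ominus> p \<otimes> C \<in> J"
      using insert.IH[of u] insert.prems c f by (simp add: a_def p_def C_def P_def)
    have IH2: "b \<ominus> q \<otimes> C \<in> J"
      using insert.IH[of "u \<otimes> f t"] v c f by (simp add: b_def q_def C_def P_def)
    have q: "q \<in> J" unfolding q_def by (rule tr[OF v])
    have prodC: "(\<Otimes>t\<in>insert t T. c t) = c t \<otimes> C"
      unfolding C_def using insert.hyps c ct by simp
    have prodP: "(\<Otimes>t\<in>insert t T. c t \<ominus> s i (f t)) = (c t \<ominus> s i (f t)) \<otimes> P i" if "i \<in> I" for i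
      unfolding P_def using insert.hyps c ct f ft that assms(4) sc
      by (subst finprod_insert) (auto simp: Pi_def subset_iff)
    have summand: "s i u \<otimes> (\<Otimes>t\<in>insert t T. c t \<ominus> s i (f t))
        = c t \<otimes> (s i u \<otimes> P i) \<oplus> (\<ominus> \<one>) \<otimes> (s i (u \<otimes> f t) \<otimes> P i)" if i: "i \<in> I" for i
    proof -
      have "s i (u \<otimes> f t) = s i u \<otimes> s i (f t)"
        using ring_hom_mult[OF s[OF i]] uc ft by simp
      moreover have "s i u \<in> carrier R" "s i (f t) \<in> carrier R" "P i \<in> carrier R"
        using sc Pc uc ft i by auto
      ultimately show ?thesis
        unfolding prodP[OF i] using ct by algebra
    qed
    have "(\<Oplus>i\<in>I. s i u \<otimes> (\<Otimes>t\<in>insert t T. c t \<ominus> s i (f t)))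
        = (\<Oplus>i\<in>I. c t \<otimes> (s i u \<otimes> P i) \<oplus> (\<ominus> \<one>) \<otimes> (s i (u \<otimes> f t) \<otimes> P i))"
      using sc Pc uc ft ct summand by (intro finsum_cong') auto
    also have "\<dots> = (\<Oplus>i\<in>I. c t \<otimes> (s i u \<otimes> P i)) \<oplus> (\<Oplus>i\<in>I. (\<ominus> \<one>) \<otimes> (s i (u \<otimes> f t) \<otimes> P i))"
      using sc Pc uc ft ct by (intro finsum_addf) auto
    also have "\<dots> = c t \<otimes> a \<oplus> (\<ominus> \<one>) \<otimes> b"
      unfolding a_def b_def using sc Pc uc ft ct assms(1)
      by (subst (1 2) finsum_rdistr) auto
    finally have sum: "(\<Oplus>i\<in>I. s i u \<otimes> (\<Otimes>t\<in>insert t T. c t \<ominus> s i (f t))) = c t \<otimes> a \<oplus> (\<ominus> \<one>) \<otimes> b" .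
    have "c t \<otimes> a \<oplus> (\<ominus> \<one>) \<otimes> b \<ominus> p \<otimes> (c t \<otimes> C)
        = c t \<otimes> (a \<ominus> p \<otimes> C) \<oplus> (\<ominus> \<one>) \<otimes> (b \<ominus> q \<otimes> C) \<oplus> (\<ominus> C) \<otimes> q"
      using cl ct Cc by algebra
    also have "\<dots> \<in> J"
      using IH1 IH2 q ct Cc by (intro J.a_closed J.I_l_closed) auto
    finally show ?case
      unfolding sum prodC p_def[symmetric] .
  }
qed

text \<open>In \<open>trace_prod_minus\<close> take \<open>u = \<one>\<close> and
  \<open>c t = s t (f t)\<close>. For each \<open>i\<close> the product vanishes at its factor
  \<open>t = i\<close>, which leaves \<open>card I\<close> times the desired product in
  \<open>J\<close>; the multiple is then cancelled.\<close>

lemma (in cring) finprod_hom_mem: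
  assumes "finite I" "ideal J R" "M \<subseteq> carrier R"
    and s: "\<And>i. i \<in> I \<Longrightarrow> s i \<in> ring_hom R R"
    and M: "\<And>x y. x \<in> M \<Longrightarrow> y \<in> M \<Longrightarrow> x \<otimes> y \<in> M"
    and tr: "\<And>x. x \<in> M \<Longrightarrow> (\<Oplus>i\<in>I. s i x) \<in> J"
    and f: "f \<in> I \<rightarrow> M"
    and unit: "[card I] \<cdot> \<one> \<in> Units R"
  shows "(\<Otimes>i\<in>I. s i (f i)) \<in> J"
proof -
  interpret J: ideal J R by fact
  have sc: "s i x \<in> carrier R" if "i \<in> I" "x \<in> carrier R" for i x
    using s[OF that(1)] that(2) by (rule ring_hom_closed)
  let ?c = "\<lambda>i. s i (f i)"
  have c: "?c \<in> I \<rightarrow> carrier R" using f sc assms(3) by (auto simp: Pi_def subset_iff)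
  have d: "(\<lambda>t. ?c t \<ominus> s i (f t)) \<in> I \<rightarrow> carrier R" if "i \<in> I" for i
    using c that f sc assms(3) by (auto simp: Pi_def subset_iff)
  let ?C = "\<Otimes>i\<in>I. ?c i"
  have C: "?C \<in> carrier R" using c by simp
  have vanish: "(\<Otimes>t\<in>I. ?c t \<ominus> s i (f t)) = \<zero>" if i: "i \<in> I" for i
  proof -
    have "(\<Otimes>t\<in>I. ?c t \<ominus> s i (f t)) = (\<Otimes>t\<in>insert i (I - {i}). ?c t \<ominus> s i (f t))"
      using i by (simp add: insert_absorb)
    also have "\<dots> = (?c i \<ominus> s i (f i)) \<otimes> (\<Otimes>t\<in>I - {i}. ?c t \<ominus> s i (f t))"
      using assms(1) d[OF i] i by (subst finprod_insert) (auto simp: Pi_def)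
    also have "?c i \<ominus> s i (f i) = \<zero>" using c i by (auto simp: minus_eq r_neg Pi_def)
    also have "\<zero> \<otimes> (\<Otimes>t\<in>I - {i}. ?c t \<ominus> s i (f t)) = \<zero>"
      using d[OF i] by (intro l_null finprod_closed) auto
    finally show ?thesis .
  qed
  have "(\<Oplus>i\<in>I. s i \<one> \<otimes> (\<Otimes>t\<in>I. ?c t \<ominus> s i (f t))) = (\<Oplus>i\<in>I. \<zero>)"
    using sc vanish by (intro finsum_cong') auto
  then have 0: "(\<Oplus>i\<in>I. s i \<one> \<otimes> (\<Otimes>t\<in>I. ?c t \<ominus> s i (f t))) = \<zero>" by simp
  have "(\<Oplus>i\<in>I. s i \<one>) = (\<Oplus>i\<in>I. \<one>)"
    using s by (intro finsum_cong') (auto simp: ring_hom_one)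
  then have 1: "(\<Oplus>i\<in>I. s i \<one>) = [card I] \<cdot> \<one>"
    by (simp add: add.finprod_const add_pow_def)
  have "\<zero> \<ominus> ([card I] \<cdot> \<one>) \<otimes> ?C \<in> J"
    using trace_prod_minus[OF assms(1,1,2,3) s M tr, of \<one> f ?c] f c 0 1 by simp
  then have "\<ominus> (\<zero> \<ominus> ([card I] \<cdot> \<one>) \<otimes> ?C) \<in> J" by simp
  then have "([card I] \<cdot> \<one>) \<otimes> ?C \<in> J"
    using C unit by (simp add: minus_eq Units_closed)
  then have "inv ([card I] \<cdot> \<one>) \<otimes> (([card I] \<cdot> \<one>) \<otimes> ?C) \<in> J"
    by (rule J.I_l_closed[OF _ Units_inv_closed[OF unit]])
  moreover have "inv ([card I] \<cdot> \<one>) \<otimes> (([card I] \<cdot> \<one>) \<otimes> ?C) = ?C"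
    using C m_assoc[OF Units_inv_closed[OF unit] Units_closed[OF unit] C] Units_l_inv[OF unit]
    by (metis l_one)
  ultimately show ?thesis by simp
qed

text \<open>Applied to \<open>\<phi> (r C)\<close>, this keeps the powers of \<open>m\<close> stable
  under translation by coset representatives.\<close>

lemma (in cring) hom_ideal_pow:
  assumes "h \<in> ring_hom R R" "ideal I R" "\<And>x. x \<in> I \<Longrightarrow> h x \<in> I"
    and "x \<in> I [^]\<^bsub>ideals_set R\<^esub> (d::nat)"
  shows "h x \<in> I [^]\<^bsub>ideals_set R\<^esub> d"
  using assms(4)
proof (induction d arbitrary: x)
  case 0
  then show ?case using ring_hom_closed[OF assms(1)] by (simp add: ideals_set_def)
next
  case (Suc d)
  interpret S: comm_monoid "ideals_set R" by (rule ideals_set_is_comm_monoid)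
  have eq: "I [^]\<^bsub>ideals_set R\<^esub> Suc d = (I [^]\<^bsub>ideals_set R\<^esub> d) \<cdot> I"
    using S.nat_pow_Suc[of I d] by (simp add: ideals_set_def)
  have id: "ideal (I [^]\<^bsub>ideals_set R\<^esub> d) R" by (rule ideal_pow_is_ideal) fact
  have "x \<in> (I [^]\<^bsub>ideals_set R\<^esub> d) \<cdot> I" using Suc.prems eq by simp
  then have "h x \<in> (I [^]\<^bsub>ideals_set R\<^esub> d) \<cdot> I"
  proof (induction rule: ideal_prod.induct)
    case (prod i j)
    then have "h (i \<otimes> j) = h i \<otimes> h j"
      using ring_hom_mult[OF assms(1)] ideal.Icarr[OF id] ideal.Icarr[OF assms(2)] by blast
    then show ?case using prod Suc.IH assms(3) by (auto intro: ideal_prod.prod)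
  next
    case (sum x y)
    then have "h (x \<oplus> y) = h x \<oplus> h y"
      using ring_hom_add[OF assms(1)] ideal_prod_in_carrier[OF id assms(2)] by blast
    then show ?case using sum by (auto intro: ideal_prod.sum)
  qed
  then show ?case using eq by simp
qed

section \<open>Right cosets and relative traces\<close>

lemma (in group) finite_rcosets:
  assumes "finite (carrier G)" "subgroup H G"
  shows "finite (rcosets H)"
  using assms rcosets_subset_PowG finite_Pow_iff finite_subset by metis

lemma (in group) rcoset_eq_repr:
  assumes "subgroup H G" "C \<in> rcosets H" "x \<in> C"
  shows "C = H #> x"
  using assms repr_independence unfolding RCOSETS_def by blast

lemma (in group) bij_betw_rcosets_mult:
  assumes "finite (carrier G)" and H: "subgroup H G" and g: "g \<in> carrier G"
  shows "bij_betw (\<lambda>C. C #> g) (rcosets H) (rcosets H)"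
proof -
  have sub: "C \<subseteq> carrier G" if "C \<in> rcosets H" for C
    using subgroup.rcosets_carrier[OF H is_group that] .
  have into: "(\<lambda>C. C #> g) ` (rcosets H) \<subseteq> rcosets H"
    using g subgroup.subset[OF H] by (auto simp: RCOSETS_def coset_mult_assoc)
  have "inj_on (\<lambda>C. C #> g) (rcosets H)"
  proof (rule inj_on_inverseI[where g = "\<lambda>C. C #> inv g"])
    fix C assume "C \<in> rcosets H"
    then show "C #> g #> inv g = C"
      using sub g by (simp add: coset_mult_assoc coset_mult_one)
  qed
  then show ?thesis
    using endo_inj_surj[OF finite_rcosets[OF assms(1) H] into] by (simp add: bij_betw_def)
qed

text \<open>Applying \<open>\<phi> g\<close> permutes the summands along the bijection sending
  \<open>C\<close> to \<open>C #> inv g\<close>. The chosen representatives need not match under it,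
  but they differ by an element of \<open>H\<close>, which fixes \<open>x\<close>.\<close>

lemma relative_trace_invariant:
  fixes A (structure)
  assumes "cring A" and "group G" and fin: "finite (carrier G)"
    and "group_action G (carrier A) \<phi>"
    and iso: "\<And>g. g \<in> carrier G \<Longrightarrow> \<phi> g \<in> ring_hom A A"
    and H: "subgroup H G"
    and r: "\<And>C. C \<in> rcosets\<^bsub>G\<^esub> H \<Longrightarrow> r C \<in> C"
    and x: "x \<in> carrier A" "\<And>h. h \<in> H \<Longrightarrow> \<phi> h x = x"
    and g: "g \<in> carrier G"
  shows "\<phi> g (\<Oplus>C\<in>rcosets\<^bsub>G\<^esub> H. \<phi> (inv\<^bsub>G\<^esub> r C) x) = (\<Oplus>C\<in>rcosets\<^bsub>G\<^esub> H. \<phi> (inv\<^bsub>G\<^esub> r C) x)"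
proof -
  interpret cring A by fact
  interpret G: group G by fact
  interpret H: subgroup H G by fact
  interpret act: group_action G "carrier A" \<phi> by fact
  interpret g: ring_hom_cring A A "\<phi> g" by unfold_locales (rule iso[OF g])
  let ?R = "rcosets\<^bsub>G\<^esub> H" and ?b = "\<lambda>C. C #>\<^bsub>G\<^esub> inv\<^bsub>G\<^esub> g"
  have rc: "r C \<in> carrier G" if "C \<in> ?R" for C
    using H.rcosets_carrier[OF \<open>group G\<close> that] r[OF that] by blast
  have cl: "(\<lambda>C. \<phi> (inv\<^bsub>G\<^esub> r C) x) \<in> ?R \<rightarrow> carrier A"
    using ring_hom_closed[OF iso x(1)] rc by simp
  have bij: "bij_betw ?b ?R ?R"
    using G.bij_betw_rcosets_mult[OF fin H] g by simp
  have move: "\<phi> g (\<phi> (inv\<^bsub>G\<^esub> r C) x) = \<phi> (inv\<^bsub>G\<^esub> r (?b C)) x" if C: "C \<in> ?R" for C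
  proof -
    have bC: "?b C \<in> ?R" using bij C by (auto simp: bij_betw_def)
    have "r (?b C) \<in> ?b C" using r bC by blast
    moreover have "?b C = H #>\<^bsub>G\<^esub> (r C \<otimes>\<^bsub>G\<^esub> inv\<^bsub>G\<^esub> g)"
      using G.rcoset_eq_repr[OF H C r[OF C]] g rc[OF C] H.subset
      by (metis G.coset_mult_assoc G.inv_closed)
    ultimately obtain h where h: "h \<in> H" "r (?b C) = h \<otimes>\<^bsub>G\<^esub> (r C \<otimes>\<^bsub>G\<^esub> inv\<^bsub>G\<^esub> g)"
      by (auto simp: r_coset_def)
    \<comment> \<open>After inversion the discrepancy \<open>h\<close> stands on the right, so it
      acts on \<open>x\<close> first and disappears.\<close>
    have "inv\<^bsub>G\<^esub> r (?b C) = g \<otimes>\<^bsub>G\<^esub> inv\<^bsub>G\<^esub> r C \<otimes>\<^bsub>G\<^esub> inv\<^bsub>G\<^esub> h"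
      using h g rc[OF C] H.mem_carrier by (simp add: G.inv_mult_group)
    then have "\<phi> (inv\<^bsub>G\<^esub> r (?b C)) x = \<phi> (g \<otimes>\<^bsub>G\<^esub> inv\<^bsub>G\<^esub> r C) (\<phi> (inv\<^bsub>G\<^esub> h) x)"
      using act.composition_rule[OF x(1)] h g rc[OF C] H.mem_carrier by simp
    also have "\<dots> = \<phi> g (\<phi> (inv\<^bsub>G\<^esub> r C) x)"
      using act.composition_rule[OF x(1)] h(1) g rc[OF C] x(2) H.m_inv_closed by simp
    finally show ?thesis by simp
  qed
  have "\<phi> g (\<Oplus>C\<in>?R. \<phi> (inv\<^bsub>G\<^esub> r C) x) = (\<Oplus>C\<in>?R. \<phi> g (\<phi> (inv\<^bsub>G\<^esub> r C) x))"
    using cl by (simp add: comp_def)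
  also have "\<dots> = (\<Oplus>C\<in>?R. \<phi> (inv\<^bsub>G\<^esub> r (?b C)) x)"
    using cl move bij by (intro finsum_cong') (auto simp: bij_betw_def Pi_def)
  also have "\<dots> = (\<Oplus>C\<in>?b ` ?R. \<phi> (inv\<^bsub>G\<^esub> r C) x)"
    using cl bij by (intro finsum_reindex[symmetric]) (auto simp: bij_betw_def)
  also have "?b ` ?R = ?R" using bij by (simp add: bij_betw_def)
  finally show ?thesis .
qed

section \<open>Comparison of the two values of \<open>eta\<close>\<close>

theorem theorem2p1:
  fixes A :: "('a, 'b) ring_scheme"
    and G :: "('g, 'c) monoid_scheme"
    and \<phi> :: "'g \<Rightarrow> 'a \<Rightarrow> 'a"
    and m :: "'a set" and H :: "'g set"
  assumes "cring A"
    and "group G" and "finite (carrier G)"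
    and "group_action G (carrier A) \<phi>"
    and "\<And>g. g \<in> carrier G \<Longrightarrow> \<phi> g \<in> ring_iso A A"
    and "ideal m A"
    and "\<And>g x. g \<in> carrier G \<Longrightarrow> x \<in> m \<Longrightarrow> \<phi> g x \<in> m"
    and "subgroup H G"
    and "[card (rcosets\<^bsub>G\<^esub> H)] \<cdot>\<^bsub>A\<^esub> \<one>\<^bsub>A\<^esub> \<in> Units A"
  shows "eta A G \<phi> m \<le> enat (card (rcosets\<^bsub>G\<^esub> H)) * eta A (G\<lparr>carrier := H\<rparr>) \<phi> m"
proof -
  interpret cring A by fact
  interpret G: group G by fact
  interpret H: subgroup H G by fact
  interpret act: group_action G "carrier A" \<phi> by fact
  interpret m: ideal m A by fact
  interpret S: comm_monoid "ideals_set A" by (rule ideals_set_is_comm_monoid)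
  let ?R = "rcosets\<^bsub>G\<^esub> H" and ?J = "Idl\<^bsub>A\<^esub> (fixed_points G \<phi> m)"
    and ?M = "fixed_points (G\<lparr>carrier := H\<rparr>) \<phi> m"
  let ?P = "\<lambda>d::nat. m [^]\<^bsub>ideals_set A\<^esub> d \<subseteq> Idl\<^bsub>A\<^esub> ?M"
  have hom: "\<phi> g \<in> ring_hom A A" if "g \<in> carrier G" for g
    using assms(5)[OF that] by (simp add: ring_iso_def)
  have fin: "finite ?R" using G.finite_rcosets assms by blast
  \<comment> \<open>A nonzero index matters when the value for \<open>H\<close> is infinite, since
    \<open>0 * \<infinity> = 0\<close> in \<open>enat\<close>.\<close>
  have "?R \<noteq> {}" using H.subgroup_in_rcosets[OF \<open>group G\<close>] by blast
  then have pos: "card ?R \<noteq> 0" using fin by simp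
  define r where "r C = (SOME x. x \<in> C)" for C :: "'g set"
  have r: "r C \<in> C" if "C \<in> ?R" for C
    unfolding r_def using H.rcosets_non_empty[OF that] by (meson ex_in_conv someI_ex)
  have rc: "r C \<in> carrier G" if "C \<in> ?R" for C
    using H.rcosets_carrier[OF \<open>group G\<close> that] r[OF that] by blast
  \<comment> \<open>\<^term>\<open>?R\<close> consists of right cosets, so inverses of their elements represent the left cosets.\<close>
  define s where "s C = \<phi> (inv\<^bsub>G\<^esub> r C)" for C
  have s: "s C \<in> ring_hom A A" if "C \<in> ?R" for C
    unfolding s_def using hom rc that by simp
  have mc: "m \<subseteq> carrier A" by (rule m.a_subset)
  have J: "ideal ?J A" using mc by (intro genideal_ideal) (auto simp: fixed_points_def)
  have M: "?M \<subseteq> carrier A" using mc by (auto simp: fixed_points_def)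
  have M_mult: "x \<otimes>\<^bsub>A\<^esub> y \<in> ?M" if "x \<in> ?M" "y \<in> ?M" for x y
  proof -
    have "\<phi> h (x \<otimes>\<^bsub>A\<^esub> y) = x \<otimes>\<^bsub>A\<^esub> y" if "h \<in> H" for h
      using ring_hom_mult[OF hom[OF H.mem_carrier[OF that]], of x y] \<open>x \<in> ?M\<close> \<open>y \<in> ?M\<close> M that
      by (auto simp: fixed_points_def)
    then show ?thesis
      using that mc by (auto simp: fixed_points_def m.I_r_closed)
  qed
  \<comment> \<open>The trace stays in \<open>m\<close> because \<open>m\<close> is
    \<open>G\<close>-invariant, and it is fixed by \<open>G\<close>; hence it is one of the
    generators of \<open>?J\<close>.\<close>
  have tr: "(\<Oplus>\<^bsub>A\<^esub>C\<in>?R. s C x) \<in> ?J" if x: "x \<in> ?M" for x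
  proof -
    have xm: "x \<in> m" "\<And>h. h \<in> H \<Longrightarrow> \<phi> h x = x" using x by (auto simp: fixed_points_def)
    have xc: "x \<in> carrier A" using xm mc by blast
    have sm: "s C x \<in> m" if "C \<in> ?R" for C
      unfolding s_def using assms(7) rc that xm by simp
    have "(\<Oplus>\<^bsub>A\<^esub>C\<in>F. s C x) \<in> m" if "finite F" "F \<subseteq> ?R" for F
      using that
    proof (induction F rule: finite_induct)
      case (insert C F)
      then have "(\<Oplus>\<^bsub>A\<^esub>C\<in>insert C F. s C x) = s C x \<oplus>\<^bsub>A\<^esub> (\<Oplus>\<^bsub>A\<^esub>C\<in>F. s C x)"
        using sm mc by (intro finsum_insert) auto
      then show ?case using insert sm by simp
    qed simp
    then have "(\<Oplus>\<^bsub>A\<^esub>C\<in>?R. s C x) \<in> m" using fin by blast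
    moreover have "\<phi> g (\<Oplus>\<^bsub>A\<^esub>C\<in>?R. s C x) = (\<Oplus>\<^bsub>A\<^esub>C\<in>?R. s C x)" if "g \<in> carrier G" for g
      unfolding s_def
      using relative_trace_invariant[OF assms(1-4) hom assms(8) r xc xm(2) that] .
    ultimately have "(\<Oplus>\<^bsub>A\<^esub>C\<in>?R. s C x) \<in> fixed_points G \<phi> m"
      by (simp add: fixed_points_def)
    then show ?thesis
      using genideal_self[of "fixed_points G \<phi> m"] mc by (auto simp: fixed_points_def)
  qed
  have prodK: "(\<Otimes>\<^bsub>A\<^esub>C\<in>?R. s C (f C)) \<in> ?J" if "f \<in> ?R \<rightarrow> Idl\<^bsub>A\<^esub> ?M" for f
  proof (rule finprod_hom_genideal[OF fin M J s _ that])
    fix f assume "f \<in> ?R \<rightarrow> ?M"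
    then show "(\<Otimes>\<^bsub>A\<^esub>C\<in>?R. s C (f C)) \<in> ?J"
      by (intro finprod_hom_mem[OF fin J M s M_mult tr]) (use assms(9) in auto)
  qed
  have key: "eta A G \<phi> m \<le> enat (card ?R * d)" if d: "?P d" for d
  proof -
    let ?I = "m [^]\<^bsub>ideals_set A\<^esub> d"
    have I: "ideal ?I A" by (rule ideal_pow_is_ideal) fact
    have "?I [^]\<^bsub>ideals_set A\<^esub> card ?R \<subseteq> ?J"
    proof (rule ideal_pow_card_subset[OF I fin J])
      fix f assume f: "f \<in> ?R \<rightarrow> ?I"
      have fc: "f C \<in> carrier A" if "C \<in> ?R" for C
        using f that ideal.Icarr[OF I] by blast
      \<comment> \<open>Each \<open>f C\<close> is rewritten as \<open>s C\<close> applied to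
        \<open>\<phi> (r C) (f C)\<close>. The latter is again in \<open>?I\<close>, hence in
        \<open>Idl ?M\<close>, so \<open>prodK\<close> applies to the product of the
        \<open>f C\<close>.\<close>
      have "\<phi> (r C) (f C) \<in> Idl\<^bsub>A\<^esub> ?M" if "C \<in> ?R" for C
        using hom_ideal_pow[OF hom[OF rc[OF that]] assms(6,7)] rc f d that by blast
      then have "(\<Otimes>\<^bsub>A\<^esub>C\<in>?R. s C (\<phi> (r C) (f C))) \<in> ?J"
        by (intro prodK) auto
      moreover have "s C (\<phi> (r C) (f C)) = f C" if "C \<in> ?R" for C
        unfolding s_def using act.orbit_sym_aux[OF rc[OF that] fc[OF that]] by simp
      then have "(\<Otimes>\<^bsub>A\<^esub>C\<in>?R. s C (\<phi> (r C) (f C))) = (\<Otimes>\<^bsub>A\<^esub>C\<in>?R. f C)"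
        using fc by (intro finprod_cong') auto
      ultimately show "(\<Otimes>\<^bsub>A\<^esub>C\<in>?R. f C) \<in> ?J" by simp
    qed
    moreover have "m \<in> carrier (ideals_set A)" using assms(6) by (simp add: ideals_set_def)
    ultimately have "m [^]\<^bsub>ideals_set A\<^esub> (card ?R * d) \<subseteq> ?J"
      by (simp add: S.nat_pow_pow mult.commute)
    then show ?thesis unfolding eta_def by (intro Inf_lower) blast
  qed
  show ?thesis
  proof (cases "\<exists>d. ?P d")
    case True
    let ?E = "{enat d | d. ?P d}"
    \<comment> \<open>A nonempty set in \<open>enat\<close> attains its infimum, which supplies the
      exponent \<open>d\<close> for \<open>key\<close>.\<close>
    have "Inf ?E \<in> ?E"
      using True by (auto simp: Inf_enat_def intro!: LeastI_ex[of "\<lambda>x. x \<in> ?E", simplified])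
    then obtain d where "?P d" "eta A (G\<lparr>carrier := H\<rparr>) \<phi> m = enat d"
      unfolding eta_def by blast
    then show ?thesis using key by simp
  next
    case False
    then have "eta A (G\<lparr>carrier := H\<rparr>) \<phi> m = \<infinity>"
      unfolding eta_def by (simp add: top_enat_def)
    then show ?thesis using pos by (simp add: zero_enat_def)
  qed
qed

end
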